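(* Let $(f_n)_{n\ge0}$ be the tribonacci sequence defined by $f_0=0$, $f_1=1$, $f_2=3$, $f_3=6$ and $f_i=f_{i-1}+f_{i-2}+f_{i-3}$ for $i\ge 4$. Let $\mathsf N_1$ be the set of $w\in\{-1,1\}^{\mathbb N}$ such that $\sum_{j=1}^n f_j w_j=f_1$ for infinitely many $n\ge1$. Then, with respect to the metric $d(u,v)=\sum_{i=1}^\infty |u_i-v_i|/2^i$ on $\{-1,1\}^{\mathbb N}$, $$\dim_H(\mathsf N_1)=\dim_P(\mathsf N_1)=\dim_B(\mathsf N_1)=\frac14.$$
   Context: $\mathbb N$ denotes the set of positive integers, and $\mathcal A=\{-1,1\}^{\mathbb N}$ is the space of sequences $w=(w_i)_{i\ge1}$ with $w_i\in\{-1,1\}$, endowed with the metric $d$ given in the claim (a compact metric space). $\dim_H$, $\dim_P$, $\dim_B$ denote respectively the Hausdorff, packing and box-counting dimensions in the metric space $(\mathcal A,d)$. *)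

theory Defs
  imports "HOL-Analysis.Analysis" "HOL-Library.Extended_Nat"
begin

context Metric_space
begin

definition ediam :: "'a set \<Rightarrow> ennreal" where
  "ediam U = (SUP x\<in>U. SUP y\<in>U. ennreal (d x y))"

text \<open>
  The \<open>s\<close>-th power of the diameter, with the usual conventions for \<open>s = 0\<close>: every nonempty set
  counts \<open>1\<close> (including singletons, for which \<open>powr\<close> would give \<open>0\<close>). The empty set counts \<open>0\<close>
  for every \<open>s\<close>, so sequences padded with empty sets represent finite families. Only sets of
  finite diameter are measured below, so passing through \<^term>\<open>enn2real\<close> is harmless.
\<close>
definition diam_pow :: "real \<Rightarrow> 'a set \<Rightarrow> ennreal" where
  "diam_pow s U =
     (if U = {} then 0 else if s = 0 then 1 else ennreal (enn2real (ediam U) powr s))"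


subsection \<open>Hausdorff dimension\<close>

definition hausdorff_premeasure :: "real \<Rightarrow> real \<Rightarrow> 'a set \<Rightarrow> ennreal" where
  "hausdorff_premeasure s \<delta> A =
     (INF U \<in> {U :: nat \<Rightarrow> 'a set.
                (\<forall>i. U i \<subseteq> M \<and> ediam (U i) \<le> ennreal \<delta>) \<and> A \<subseteq> (\<Union>i. U i)}.
        \<Sum>i. diam_pow s (U i))"

definition hausdorff_measure :: "real \<Rightarrow> 'a set \<Rightarrow> ennreal" where
  "hausdorff_measure s A = (SUP \<delta>\<in>{0<..}. hausdorff_premeasure s \<delta> A)"

definition hausdorff_dim :: "'a set \<Rightarrow> ereal" where
  "hausdorff_dim A = Inf {ereal s | s. 0 \<le> s \<and> hausdorff_measure s A = 0}"


subsection \<open>Packing dimension\<close>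

text \<open>
  A \<open>\<delta>\<close>-packing of \<open>A\<close> is a countable disjoint family of closed balls centred in \<open>A\<close> with radii at
  most \<open>\<delta>\<close>; the balls are balls of the ambient space, and they are weighted by their diameters.
\<close>
definition packing :: "real \<Rightarrow> 'a set \<Rightarrow> (nat \<Rightarrow> 'a set) \<Rightarrow> bool" where
  "packing \<delta> A U \<longleftrightarrow>
     disjoint_family U \<and>
     (\<forall>i. U i = {} \<or> (\<exists>x\<in>A. \<exists>r. 0 < r \<and> r \<le> \<delta> \<and> U i = mcball x r))"

definition packing_premeasure :: "real \<Rightarrow> 'a set \<Rightarrow> ennreal" where
  "packing_premeasure s A =
     (INF \<delta>\<in>{0<..}. SUP U\<in>{U. packing \<delta> A U}. \<Sum>i. diam_pow s (U i))"

definition packing_measure :: "real \<Rightarrow> 'a set \<Rightarrow> ennreal" where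
  "packing_measure s A =
     (INF B \<in> {B :: nat \<Rightarrow> 'a set. (\<forall>i. B i \<subseteq> M) \<and> A \<subseteq> (\<Union>i. B i)}.
        \<Sum>i. packing_premeasure s (B i))"

definition packing_dim :: "'a set \<Rightarrow> ereal" where
  "packing_dim A = Inf {ereal s | s. 0 \<le> s \<and> packing_measure s A = 0}"


subsection \<open>Box-counting dimension\<close>

text \<open>The value is \<open>\<infinity>\<close> when \<open>A\<close> has no finite cover by sets of diameter at most \<open>\<delta>\<close>.\<close>
definition covering_number :: "real \<Rightarrow> 'a set \<Rightarrow> enat" where
  "covering_number \<delta> A =
     (INF C \<in> {C. finite C \<and> (\<forall>U\<in>C. U \<subseteq> M \<and> ediam U \<le> ennreal \<delta>) \<and> A \<subseteq> \<Union>C}.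
        enat (card C))"

definition box_ratio :: "'a set \<Rightarrow> real \<Rightarrow> ereal" where
  "box_ratio A \<delta> =
     (case covering_number \<delta> A of enat n \<Rightarrow> ereal (ln (real n) / - ln \<delta>) | \<infinity> \<Rightarrow> \<infinity>)"

definition lower_box_dim :: "'a set \<Rightarrow> ereal" where
  "lower_box_dim A = Liminf (at_right 0) (box_ratio A)"

definition upper_box_dim :: "'a set \<Rightarrow> ereal" where
  "upper_box_dim A = Limsup (at_right 0) (box_ratio A)"

text \<open>The box-counting dimension exists only when the lower and upper ones agree.\<close>
definition has_box_dim :: "'a set \<Rightarrow> ereal \<Rightarrow> bool" where
  "has_box_dim A D \<longleftrightarrow> lower_box_dim A = D \<and> upper_box_dim A = D"

end


subsection \<open>The space of sign sequences\<close>

text \<open>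
  Sequences indexed by the positive integers are extensional functions on \<open>{1..}\<close>: their value
  at \<open>0\<close> is the fixed junk value \<^term>\<open>undefined\<close>, so that equality is equality of the \<open>w\<^sub>i\<close>, \<open>i \<ge> 1\<close>.
\<close>
definition sign_seqs :: "(nat \<Rightarrow> int) set" where
  "sign_seqs = {1..} \<rightarrow>\<^sub>E {-1, 1}"

text \<open>
  The unordered sum \<^const>\<open>infsum\<close> agrees with the series on \<^term>\<open>sign_seqs\<close>, where it converges
  absolutely; outside it, it keeps the function nonnegative, as \<^locale>\<open>Metric_space\<close> demands.
\<close>
definition sign_dist :: "(nat \<Rightarrow> int) \<Rightarrow> (nat \<Rightarrow> int) \<Rightarrow> real" where
  "sign_dist u v = (\<Sum>\<^sub>\<infinity>i\<in>{1..}. \<bar>real_of_int (u i) - real_of_int (v i)\<bar> / 2 ^ i)"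

lemma sign_dist_summable:
  assumes "u \<in> sign_seqs" "v \<in> sign_seqs"
  shows "(\<lambda>i. \<bar>real_of_int (u i) - real_of_int (v i)\<bar> / 2 ^ i) summable_on {1..}"
proof -
  have "(\<lambda>i. 2 * (1/2) ^ i :: real) summable_on UNIV"
    by (intro norm_summable_imp_summable_on) (simp add: summable_mult)
  then have g: "(\<lambda>i. 2 * (1/2) ^ i :: real) summable_on {1..}"
    by (rule summable_on_subset_banach) simp
  show ?thesis
  proof (rule summable_on_comparison_test[OF g])
    fix i :: nat assume i: "i \<in> {1..}"
    have "u i \<in> {-1, 1}" "v i \<in> {-1, 1}"
      using assms i unfolding sign_seqs_def by (auto simp: PiE_iff)
    then have "\<bar>real_of_int (u i) - real_of_int (v i)\<bar> \<le> 2" by auto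
    then show "\<bar>real_of_int (u i) - real_of_int (v i)\<bar> / 2 ^ i \<le> 2 * (1/2) ^ i"
      by (simp add: power_one_over divide_right_mono)
  qed auto
qed

lemma Metric_space_sign_seqs: "Metric_space sign_seqs sign_dist"
proof
  fix u v show "0 \<le> sign_dist u v"
    unfolding sign_dist_def by (rule infsum_nonneg) simp
  show "sign_dist u v = sign_dist v u"
    unfolding sign_dist_def by (simp add: abs_minus_commute)
next
  fix u v assume uv: "u \<in> sign_seqs" "v \<in> sign_seqs"
  show "sign_dist u v = 0 \<longleftrightarrow> u = v"
  proof
    assume 0: "sign_dist u v = 0"
    have "u i = v i" if "i \<in> {1..}" for i
    proof -
      have "\<bar>real_of_int (u i) - real_of_int (v i)\<bar> / 2 ^ i = 0"
        using 0 sign_dist_summable[OF uv] that unfolding sign_dist_def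
        by (intro nonneg_infsum_le_0D[where A = "{1..}" and
              f = "\<lambda>i. \<bar>real_of_int (u i) - real_of_int (v i)\<bar> / 2 ^ i"]) auto
      then show ?thesis by simp
    qed
    then show "u = v"
      using uv unfolding sign_seqs_def by (intro PiE_ext) auto
  qed (simp add: sign_dist_def)
next
  fix u v w assume *: "u \<in> sign_seqs" "v \<in> sign_seqs" "w \<in> sign_seqs"
  let ?D = "\<lambda>u v i. \<bar>real_of_int (u i) - real_of_int (v i)\<bar> / 2 ^ i"
  have "sign_dist u w \<le> (\<Sum>\<^sub>\<infinity>i\<in>{1..}. ?D u v i + ?D v w i)"
    unfolding sign_dist_def
  proof (rule infsum_mono)
    show "?D u w i \<le> ?D u v i + ?D v w i" for i
      unfolding add_divide_distrib[symmetric] by (rule divide_right_mono) auto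
  qed (intro summable_on_add sign_dist_summable *)+
  also have "\<dots> = sign_dist u v + sign_dist v w"
    unfolding sign_dist_def using * by (intro infsum_add sign_dist_summable)
  finally show "sign_dist u w \<le> sign_dist u v + sign_dist v w" .
qed


subsection \<open>The tribonacci sequence and the set of sign sequences\<close>

text \<open>The recursion starts only at index \<open>4\<close>: \<open>f 3 = 6\<close> is not the sum of its predecessors.\<close>
fun trib :: "nat \<Rightarrow> int" where
  "trib 0 = 0"
| "trib (Suc 0) = 1"
| "trib (Suc (Suc 0)) = 3"
| "trib (Suc (Suc (Suc 0))) = 6"
| "trib (Suc (Suc (Suc (Suc n)))) =
     trib (Suc (Suc (Suc n))) + trib (Suc (Suc n)) + trib (Suc n)"

definition N1 :: "(nat \<Rightarrow> int) set" where
  "N1 = {w \<in> sign_seqs. infinite {n. n \<ge> 1 \<and> (\<Sum>j=1..n. trib j * w j) = trib 1}}"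

end

theory Submission
  imports Defs
begin

text \<open>
  The set is a Cantor set in disguise. If a partial sum up to some \<open>n \<ge> 4\<close> equals \<open>1\<close>, then the
  last four terms must cancel: since \<open>f\<^sub>n\<close> is the sum of its three predecessors, any other choice of
  signs there leaves at least \<open>2 f\<^sub>n\<^sub>-\<^sub>3\<close> in absolute value, more than the remaining terms can
  compensate (\<open>sum_trib_less\<close>). Hence the partial sum up to \<open>n - 4\<close> equals \<open>1\<close> too. Descending to \<open>n = 1\<close> shows
  that the set consists precisely of the sequences that start with \<open>1\<close> and continue with blocks
  \<open>(s, s, s, -s)\<close>, one free sign \<open>s\<close> for each block (\<open>N1_eq_range_block_seq\<close>).

  The free signs are a sequence of bits. Reading them as a binary expansion gives a map
  \<open>cantor_point\<close> from \<open>{0..<1}\<close> into the set. Sequences agreeing on \<open>k\<close> bits are at distance at most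
  \<open>16\<^sup>-\<^sup>k\<close> and sequences that differ at bit \<open>k\<close> at distance at least \<open>16\<^sup>-\<^sup>k / 2\<close>, whereas the
  parameters with \<open>k\<close> prescribed bits form an interval of length \<open>2\<^sup>-\<^sup>k\<close>, the fourth root of
  \<open>16\<^sup>-\<^sup>k\<close>. So the image of Lebesgue measure behaves like the \<open>1/4\<close>-th power of the radius, and the
  dimensions follow by comparison with this measure.

  For the lower bounds on the Hausdorff and box dimensions, the preimages of the members of a cover
  have outer Lebesgue measure at most \<open>2\<close> times the \<open>1/4\<close>-th power of their diameters, and they cover
  an interval of length \<open>1\<close>. The \<open>2 ^ k\<close> cylinders of level \<open>k\<close> provide efficient covers for the upper
  bounds. For packings, disjoint balls contain images of disjoint intervals of length comparable
  to the \<open>1/4\<close>-th power of the radii, which bounds the packing premeasure from above. Conversely, for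
  exponents below \<open>1/4\<close>, the packing premeasure of every set dominates the outer measure of its preimage
  (\<open>outer_measure_le_packing_premeasure\<close>), as selecting one point in each cylinder that meets the
  set gives a packing by balls of equal radius. Countable subadditivity carries this over
  from the premeasure to the packing measure.
\<close>

section \<open>Sign patterns with partial sums equal to one\<close>

lemma trib_nonneg: "0 \<le> trib n"
  by (induction n rule: trib.induct) auto

lemma trib_add_4: "trib (n + 4) = trib (n + 3) + trib (n + 2) + trib (n + 1)"
  by (simp add: numeral_eq_Suc)

text \<open>
  The constant \<open>3/2\<close> lies below the growth rate of the tribonacci numbers, about \<open>1.84\<close>, and is
  just what the induction step of the next lemma consumes.
\<close>
lemma trib_growth: "3 * trib n \<le> 2 * trib (Suc n)"
proof (induction n rule: trib.induct)
  case (5 n)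
  then show ?case
    using trib_nonneg[of n] trib_nonneg[of "Suc n"] trib_nonneg[of "Suc (Suc n)"]
      trib_nonneg[of "Suc (Suc (Suc n))"] by (cases n) auto
qed auto

text \<open>
  A wrong sign at index \<open>n + 1\<close> would be too expensive to be repaired by the first \<open>n\<close> signs:
  this is what forces uniqueness of the sign patterns below.
\<close>
lemma sum_trib_less: "(\<Sum>j=1..n. trib j) + 1 < 2 * trib (Suc n)"
proof (induction n)
  case (Suc n)
  then show ?case using trib_growth[of "Suc n"] by simp
qed simp

lemma sign_seqs_cases:
  assumes "w \<in> sign_seqs" "1 \<le> n"
  obtains "w n = 1" | "w n = -1"
  using assms unfolding sign_seqs_def by (fastforce simp: PiE_iff)

lemma abs_signed_sum_le:
  assumes "w \<in> sign_seqs"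
  shows "\<bar>\<Sum>j=1..n. trib j * w j\<bar> \<le> (\<Sum>j=1..n. trib j)"
proof -
  have "\<bar>trib j * w j\<bar> = trib j" if "1 \<le> j" for j
    using assms that trib_nonneg[of j] by (cases rule: sign_seqs_cases[OF assms that]) auto
  then show ?thesis
    using sum_abs[of "\<lambda>j. trib j * w j" "{1..n}"] by simp
qed

text \<open>
  By the recursion, \<open>f (n + 4)\<close> can be distributed over its three predecessors; the terms of the
  last four indices vanish together exactly when each bracket does.
\<close>
lemma signed_sum_add_4:
  "(\<Sum>j=1..n + 4. trib j * w j) = (\<Sum>j=1..n. trib j * w j)
     + trib (n + 1) * (w (n + 1) + w (n + 4)) + trib (n + 2) * (w (n + 2) + w (n + 4))
     + trib (n + 3) * (w (n + 3) + w (n + 4))"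
proof -
  have "n + 4 = Suc (Suc (Suc (Suc n)))" by simp
  then show ?thesis using trib_add_4[of n] by (simp add: algebra_simps numeral_eq_Suc)
qed

text \<open>
  Each bracket is \<open>0\<close>, \<open>2\<close> or \<open>-2\<close>, and brackets that do not vanish all have the sign of \<open>z\<close>. So a
  nonzero bracket contributes at least \<open>2 * a\<close> in absolute value and cannot be balanced by \<open>r\<close>.
\<close>
lemma dominated_signs_cancel:
  fixes a b c r w x y z :: int
  assumes "r + a * (w + z) + b * (x + z) + c * (y + z) = 1"
    and "\<bar>r\<bar> + 1 < 2 * a" "a \<le> b" "b \<le> c"
    and "w = 1 \<or> w = -1" "x = 1 \<or> x = -1" "y = 1 \<or> y = -1" "z = 1 \<or> z = -1"
  shows "w = - z \<and> x = - z \<and> y = - z"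
  using assms by (elim disjE) simp_all

lemma top_block_cancels:
  assumes w: "w \<in> sign_seqs" and 1: "(\<Sum>j=1..n + 4. trib j * w j) = 1"
  shows "w (n + 1) = - w (n + 4)" "w (n + 2) = - w (n + 4)" "w (n + 3) = - w (n + 4)"
proof -
  have "trib (n + 1) \<le> trib (n + 2)" "trib (n + 2) \<le> trib (n + 3)"
    using trib_growth[of "n + 1"] trib_growth[of "n + 2"]
      trib_nonneg[of "n + 1"] trib_nonneg[of "n + 2"] by (simp_all add: numeral_eq_Suc)
  \<comment> \<open>The first \<open>n\<close> terms cannot compensate a nonzero bracket.\<close>
  moreover have "\<bar>\<Sum>j=1..n. trib j * w j\<bar> + 1 < 2 * trib (n + 1)"
    using abs_signed_sum_le[OF w, of n] sum_trib_less[of n] by simp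
  moreover have "w (n + 1) = 1 \<or> w (n + 1) = -1" "w (n + 2) = 1 \<or> w (n + 2) = -1"
    "w (n + 3) = 1 \<or> w (n + 3) = -1" "w (n + 4) = 1 \<or> w (n + 4) = -1"
    using w by (auto simp: sign_seqs_def PiE_iff)
  ultimately have "w (n + 1) = - w (n + 4) \<and> w (n + 2) = - w (n + 4) \<and> w (n + 3) = - w (n + 4)"
    using 1[unfolded signed_sum_add_4]
    by (intro dominated_signs_cancel[where a = "trib (n + 1)" and b = "trib (n + 2)"
          and c = "trib (n + 3)" and r = "\<Sum>j=1..n. trib j * w j"]) simp_all
  then show "w (n + 1) = - w (n + 4)" "w (n + 2) = - w (n + 4)" "w (n + 3) = - w (n + 4)"
    by blast+
qed

text \<open>
  The general element of the set: first sign \<open>1\<close>, then blocks of four signs \<open>(s, s, s, -s)\<close> at the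
  indices \<open>4 * i + 2, \<dots>, 4 * i + 5\<close>, where the bit \<open>b i\<close> selects \<open>s\<close>. The value at \<open>0\<close> is the one
  which extensionality prescribes.
\<close>
definition block_seq :: "(nat \<Rightarrow> bool) \<Rightarrow> nat \<Rightarrow> int" where
  "block_seq b n =
     (if n = 0 then undefined else if n = 1 then 1
      else (if b ((n - 2) div 4) then 1 else -1) * (if n mod 4 = 1 then -1 else 1))"

lemma block_seq_block:
  "block_seq b (4 * i + 2) = (if b i then 1 else -1)"
  "block_seq b (4 * i + 3) = (if b i then 1 else -1)"
  "block_seq b (4 * i + 4) = (if b i then 1 else -1)"
  "block_seq b (4 * i + 5) = (if b i then -1 else 1)"
proof -
  have "(4 * i + 3 - 2) div 4 = i" "(4 * i + 4 - 2) div 4 = i" "(4 * i + 5 - 2) div 4 = i"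
    "(4 * i + 2) mod 4 = 2" "(4 * i + 3) mod 4 = 3" "(4 * i + 5) mod 4 = 1" "(4 * i + 4) mod 4 = 0"
    by presburger+
  then show
  "block_seq b (4 * i + 2) = (if b i then 1 else -1)"
  "block_seq b (4 * i + 3) = (if b i then 1 else -1)"
  "block_seq b (4 * i + 4) = (if b i then 1 else -1)"
  "block_seq b (4 * i + 5) = (if b i then -1 else 1)"
    unfolding block_seq_def by simp_all
qed

lemma block_seq_in_sign_seqs: "block_seq b \<in> sign_seqs"
  unfolding sign_seqs_def by (rule PiE_I) (auto simp: block_seq_def)

lemma block_seq_signed_sum: "(\<Sum>j=1..4 * k + 1. trib j * block_seq b j) = 1"
proof (induction k)
  case (Suc k)
  have "4 * Suc k + 1 = 4 * k + 1 + 4" by simp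
  moreover have i: "4 * k + 1 + 1 = 4 * k + 2" "4 * k + 1 + 2 = 4 * k + 3"
    "4 * k + 1 + 3 = 4 * k + 4" "4 * k + 1 + 4 = 4 * k + 5" by simp_all
  have "(\<Sum>j=1..4 * k + 1 + 4. trib j * block_seq b j) = 1"
    unfolding signed_sum_add_4 unfolding i block_seq_block Suc.IH by simp
  ultimately show ?case by (simp only:)
qed (simp add: block_seq_def)

text \<open>
  Descent: if the partial sum up to \<open>n \<ge> 4\<close> equals \<open>1\<close>, then the last four terms cancel, so the
  partial sum up to \<open>n - 4\<close> equals \<open>1\<close> as well. Among \<open>n < 4\<close> only \<open>n = 1\<close> survives.
\<close>
lemma signed_sum_eq_1D:
  assumes w: "w \<in> sign_seqs"
  shows "(\<Sum>j=1..n. trib j * w j) = 1 \<Longrightarrow>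
    \<exists>k. n = 4 * k + 1 \<and> (\<forall>j\<le>n. w j = block_seq (\<lambda>i. w (4 * i + 2) = 1) j)"
proof (induction n rule: less_induct)
  case (less n)
  have pm: "w i = 1 \<or> w i = -1" if "1 \<le> i" for i
    using w that by (auto simp: sign_seqs_def PiE_iff)
  let ?v = "block_seq (\<lambda>i. w (4 * i + 2) = 1)"
  have w0: "w 0 = undefined" using w by (auto simp: sign_seqs_def PiE_iff extensional_def)
  consider "n = 0" | "n = 1" | "n = 2" | "n = 3" | "4 \<le> n" by linarith
  then show ?case
  proof cases
    case 2
    then have "w 1 = 1" using less.prems by simp
    then have "\<forall>j\<le>n. w j = ?v j"
      using 2 w0 by (auto simp: block_seq_def le_Suc_eq)
    then show ?thesis using 2 by (intro exI[of _ 0]) simp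
  next
    case 3
    then have "w 1 + 3 * w 2 = 1"
      using less.prems by (simp add: numeral_eq_Suc)
    then have False using pm[of 1] pm[of 2] by auto
    then show ?thesis ..
  next
    case 4
    then have "w 1 + 3 * w 2 + 6 * w 3 = 1"
      using less.prems by (simp add: numeral_eq_Suc)
    then have False using pm[of 1] pm[of 2] pm[of 3] by auto
    then show ?thesis ..
  next
    case 5
    then obtain m where n: "n = m + 4" by (metis add.commute le_Suc_ex)
    note eq = top_block_cancels[OF w less.prems[unfolded n]]
    have "(\<Sum>j=1..m. trib j * w j) = 1"
      using less.prems unfolding n signed_sum_add_4 eq by simp
    then obtain k where k: "m = 4 * k + 1" "\<forall>j\<le>m. w j = ?v j"
      using less.IH[of m] n by auto
    have "w (4 * k + 2) = 1 \<or> w (4 * k + 2) = -1"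
      by (rule pm) simp
    moreover have "w (4 * k + 2) = - w (4 * k + 5)" "w (4 * k + 3) = - w (4 * k + 5)"
      "w (4 * k + 4) = - w (4 * k + 5)" using eq k(1) by (simp_all add: numeral_eq_Suc)
    ultimately have "w (4 * k + 2) = ?v (4 * k + 2)" "w (4 * k + 3) = ?v (4 * k + 3)"
      "w (4 * k + 4) = ?v (4 * k + 4)" "w (4 * k + 5) = ?v (4 * k + 5)"
      unfolding block_seq_block by auto
    moreover have "j \<le> m \<or> j = 4 * k + 2 \<or> j = 4 * k + 3 \<or> j = 4 * k + 4 \<or> j = 4 * k + 5"
      if "j \<le> n" for j
      using that n k(1) by linarith
    ultimately have "\<forall>j\<le>n. w j = ?v j" using k(2) by metis
    then show ?thesis using n k(1) by (intro exI[of _ "Suc k"]) simp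
  qed (use less.prems in simp)
qed

text \<open>
  A sequence whose partial sums return to \<open>1\<close> infinitely often has block structure up to arbitrarily
  large indices, hence everywhere. So a condition that looks like a limsup set defines a compact
  Cantor set, and this is why all three dimensions can agree.
\<close>
lemma N1_eq_range_block_seq: "N1 = range block_seq"
proof (intro equalityI subsetI)
  fix w assume w: "w \<in> N1"
  let ?v = "block_seq (\<lambda>i. w (4 * i + 2) = 1)"
  have "w j = ?v j" for j
  proof -
    from w obtain n where "j < n" "(\<Sum>j=1..n. trib j * w j) = 1"
      unfolding N1_def infinite_nat_iff_unbounded by auto
    then show ?thesis
      using signed_sum_eq_1D[of w n] w unfolding N1_def by auto
  qed
  then show "w \<in> range block_seq" by blast
next
  fix w assume "w \<in> range block_seq"
  then obtain b where w: "w = block_seq b" by blast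
  have "infinite (range (\<lambda>k. 4 * k + 1 :: nat))"
    by (rule range_inj_infinite) (simp add: inj_def)
  moreover have "range (\<lambda>k. 4 * k + 1) \<subseteq> {n. n \<ge> 1 \<and> (\<Sum>j=1..n. trib j * w j) = trib 1}"
    using block_seq_signed_sum[where b = b] w by auto
  ultimately show "w \<in> N1"
    unfolding N1_def using w block_seq_in_sign_seqs finite_subset by blast
qed

section \<open>The metric on sign sequences\<close>

lemma sign_dist_le_tail:
  assumes uv: "u \<in> sign_seqs" "v \<in> sign_seqs" and eq: "\<And>j. 1 \<le> j \<Longrightarrow> j \<le> n \<Longrightarrow> u j = v j"
  shows "sign_dist u v \<le> 2 / 2 ^ n"
proof -
  let ?f = "\<lambda>i. \<bar>real_of_int (u i) - real_of_int (v i)\<bar> / 2 ^ i"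
  let ?g = "\<lambda>i. 2 * (1/2) ^ i :: real"
  have "(\<lambda>i. ?g (n + 1) * (1/2) ^ i) sums (?g (n + 1) * 2)"
    using geometric_sums[of "1/2 :: real"] by (intro sums_mult) simp
  moreover have "(\<lambda>i. ?g (n + 1) * (1/2) ^ i) = ?g \<circ> (\<lambda>i. i + (n + 1))"
    by (simp add: fun_eq_iff power_add)
  ultimately have "(?g \<circ> (\<lambda>i. i + (n + 1))) sums (2 / 2 ^ n)"
    by (simp add: power_one_over)
  then have "((?g \<circ> (\<lambda>i. i + (n + 1))) has_sum (2 / 2 ^ n)) UNIV"
    by (intro norm_summable_imp_has_sum) (auto simp: sums_iff o_def)
  moreover have "range (\<lambda>i. i + (n + 1)) = {n<..}"
    by (auto simp: image_iff) (metis add_Suc_right add.commute less_iff_Suc_add)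
  ultimately have g: "(?g has_sum (2 / 2 ^ n)) {n<..}"
    using has_sum_reindex[of "\<lambda>i. i + (n + 1)" UNIV ?g] by (simp add: inj_def)
  have f: "?f summable_on {n<..}"
    by (rule summable_on_subset_banach[OF sign_dist_summable[OF uv]]) auto
  have "sign_dist u v = (\<Sum>\<^sub>\<infinity>i\<in>{n<..}. ?f i)"
    unfolding sign_dist_def using eq by (intro infsum_cong_neutral) auto
  also have "\<dots> \<le> (\<Sum>\<^sub>\<infinity>i\<in>{n<..}. ?g i)"
  proof (rule infsum_mono[OF f])
    show "?g summable_on {n<..}" using g by (rule has_sum_imp_summable)
    fix i assume "i \<in> {n<..}"
    then have "u i \<in> {-1, 1}" "v i \<in> {-1, 1}"
      using uv unfolding sign_seqs_def by (auto simp: PiE_iff)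
    then show "?f i \<le> ?g i" by (auto simp: power_one_over)
  qed
  also have "\<dots> = 2 / 2 ^ n" using g by (rule infsumI)
  finally show ?thesis .
qed

lemma sign_dist_ge_term:
  assumes uv: "u \<in> sign_seqs" "v \<in> sign_seqs" and "1 \<le> j" "u j \<noteq> v j"
  shows "2 / 2 ^ j \<le> sign_dist u v"
proof -
  have "u j \<in> {-1, 1}" "v j \<in> {-1, 1}"
    using assms unfolding sign_seqs_def by (auto simp: PiE_iff)
  then have "2 / 2 ^ j = \<bar>real_of_int (u j) - real_of_int (v j)\<bar> / 2 ^ j"
    using \<open>u j \<noteq> v j\<close> by auto
  also have "\<dots> = (\<Sum>i\<in>{j}. \<bar>real_of_int (u i) - real_of_int (v i)\<bar> / 2 ^ i)" by simp
  also have "\<dots> \<le> sign_dist u v"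
    unfolding sign_dist_def using \<open>1 \<le> j\<close>
    by (intro finite_sum_le_infsum sign_dist_summable uv) auto
  finally show ?thesis .
qed

text \<open>
  Two points at an exactly known distance bound the diameter of a ball from below, which packings need:
  they weight balls by diameter, and a ball of radius \<open>r\<close> could be far smaller than \<open>2 * r\<close>.
\<close>
lemma sign_dist_flip:
  assumes w: "w \<in> sign_seqs" and j: "1 \<le> j"
  shows "w(j := - w j) \<in> sign_seqs" "sign_dist w (w(j := - w j)) = 2 / 2 ^ j"
proof -
  show "w(j := - w j) \<in> sign_seqs"
    using sign_seqs_cases[OF w j] w j unfolding sign_seqs_def PiE_iff extensional_def by auto
  let ?f = "\<lambda>i. \<bar>real_of_int (w i) - real_of_int ((w(j := - w j)) i)\<bar> / 2 ^ i"
  have "sign_dist w (w(j := - w j)) = (\<Sum>\<^sub>\<infinity>i\<in>{j}. ?f i)"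
    unfolding sign_dist_def using j by (intro infsum_cong_neutral) auto
  also have "\<dots> = 2 / 2 ^ j"
    by (rule sign_seqs_cases[OF w j]) simp_all
  finally show "sign_dist w (w(j := - w j)) = 2 / 2 ^ j" .
qed

section \<open>Dimension bounds from a parametrization by the unit interval\<close>

lemma outer_measure_of_UN_le:
  assumes "\<And>i. A i \<subseteq> space M"
  shows "outer_measure_of M (\<Union>i::nat. A i) \<le> (\<Sum>i. outer_measure_of M (A i))"
proof -
  obtain E where E: "\<And>i. E i \<in> sets M" "\<And>i. A i \<subseteq> E i"
    "\<And>i. outer_measure_of M (A i) = emeasure M (E i)"
    using outer_measure_of_attain[OF assms] by metis
  have "outer_measure_of M (\<Union>i. A i) \<le> outer_measure_of M (\<Union>i. E i)"
    using E(2) by (intro outer_measure_of_mono) blast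
  also have "\<dots> = emeasure M (\<Union>i. E i)"
    using E(1) by (intro outer_measure_of_eq) blast
  also have "\<dots> \<le> (\<Sum>i. emeasure M (E i))"
    using E(1) by (intro emeasure_subadditive_countably) blast
  finally show ?thesis using E(3) by simp
qed

text \<open>
  Preimages of arbitrary sets under a parametrization need not be measurable, which is why the outer
  measure appears here and below.
\<close>
lemma outer_measure_of_lborel_le_diameter:
  fixes S :: "real set"
  assumes L: "0 \<le> L" "\<And>y z. y \<in> S \<Longrightarrow> z \<in> S \<Longrightarrow> \<bar>y - z\<bar> \<le> L"
  shows "outer_measure_of lborel S \<le> ennreal L"
proof (cases "S = {}")
  case False
  have "S \<subseteq> {Inf S..Inf S + L}"
  proof
    fix y assume y: "y \<in> S"
    have low: "y - L \<le> z" if "z \<in> S" for z using L(2)[OF y that] by linarith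
    then have "bdd_below S" by (auto simp: bdd_below_def)
    moreover have "y - L \<le> Inf S" using low False by (intro cInf_greatest) auto
    ultimately show "y \<in> {Inf S..Inf S + L}" using cInf_lower[OF y] by auto
  qed
  then have "outer_measure_of lborel S \<le> outer_measure_of lborel {Inf S..Inf S + L}"
    by (rule outer_measure_of_mono)
  then show ?thesis using L(1) by simp
qed simp

context Metric_space
begin

lemma ediam_le: "(\<And>x y. x \<in> U \<Longrightarrow> y \<in> U \<Longrightarrow> d x y \<le> D) \<Longrightarrow> ediam U \<le> ennreal D"
  unfolding ediam_def by (intro SUP_least ennreal_leI)

lemma dist_le_ediam: "x \<in> U \<Longrightarrow> y \<in> U \<Longrightarrow> ennreal (d x y) \<le> ediam U"
  unfolding ediam_def by (rule SUP_upper2[of x], assumption, rule SUP_upper2[of y]) auto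

lemma ediam_mcball_le: "ediam (mcball x r) \<le> ennreal (2 * r)"
proof (rule ediam_le)
  fix y z assume "y \<in> mcball x r" "z \<in> mcball x r"
  then show "d y z \<le> 2 * r" using triangle''[of y x z] commute[of x z] by auto
qed

lemma diam_pow_le:
  assumes "ediam U \<le> ennreal D" "0 < D" "0 \<le> s"
  shows "diam_pow s U \<le> ennreal (D powr s)"
proof -
  have "enn2real (ediam U) \<le> D"
    using enn2real_mono[OF assms(1)] assms(2) by simp
  then show ?thesis
    unfolding diam_pow_def using assms by (auto intro!: ennreal_leI powr_mono2)
qed

lemma diam_pow_ge:
  assumes "x \<in> U" "y \<in> U" "0 < c" "c \<le> d x y" "ediam U < \<infinity>" "0 \<le> s"
  shows "ennreal (c powr s) \<le> diam_pow s U"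
proof -
  have "ennreal c \<le> ediam U"
    using dist_le_ediam[OF assms(1,2)] assms(4) by (meson ennreal_leI order_trans)
  then have "c \<le> enn2real (ediam U)"
    using enn2real_mono[of "ennreal c" "ediam U"] assms(3,5) by simp
  then show ?thesis
    unfolding diam_pow_def using assms by (auto intro!: ennreal_leI powr_mono2)
qed

text \<open>
  The estimate behind all lower bounds: if \<open>h\<close> expands distances in the sense of the hypothesis, then
  a set of small diameter catches little of the Lebesgue measure of the parameter interval.
\<close>
lemma outer_measure_preimage_le:
  assumes C: "0 < C" and t: "0 < t"
    and h: "\<And>y z. y \<in> {0..<1} \<Longrightarrow> z \<in> {0..<1} \<Longrightarrow> \<bar>y - z\<bar> \<le> C * d (h y) (h z) powr t"
    and U: "ediam U \<le> ennreal D" and D: "0 \<le> D"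
  shows "outer_measure_of lborel {y \<in> {0..<1}. h y \<in> U} \<le> ennreal (C * D powr t)"
proof (rule outer_measure_of_lborel_le_diameter)
  fix y z assume yz: "y \<in> {y \<in> {0..<1}. h y \<in> U}" "z \<in> {y \<in> {0..<1}. h y \<in> U}"
  then have "ennreal (d (h y) (h z)) \<le> ennreal D"
    using dist_le_ediam[of "h y" U "h z"] U by (auto intro: order_trans)
  then have "d (h y) (h z) powr t \<le> D powr t"
    using D t by (intro powr_mono2) (auto simp: ennreal_le_iff)
  then show "\<bar>y - z\<bar> \<le> C * D powr t"
    using h[of y z] yz C by (auto intro: order_trans)
qed (use C in simp)

text \<open>
  The mass distribution principle for the image of Lebesgue measure under \<open>h\<close>: the preimages of the
  members of a cover of \<open>A\<close> cover the unit interval, so their outer measures add up to at least \<open>1\<close>.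
  As only covers by sets of diameter at most \<open>1\<close> need to be considered, the exponent \<open>t\<close> may be lowered
  to \<open>s\<close> in the estimate for each member.
\<close>
lemma hausdorff_dim_ge:
  assumes C: "0 < C" and t: "0 < t"
    and h: "\<And>y z. y \<in> {0..<1} \<Longrightarrow> z \<in> {0..<1} \<Longrightarrow> \<bar>y - z\<bar> \<le> C * d (h y) (h z) powr t"
    and A: "h ` {0..<1} \<subseteq> A"
  shows "ereal t \<le> hausdorff_dim A"
  unfolding hausdorff_dim_def
proof (rule Inf_greatest, clarify)
  fix s assume s: "0 \<le> s" and zero: "hausdorff_measure s A = 0"
  show "ereal t \<le> ereal s"
  proof (rule ccontr)
    assume "\<not> ?thesis"
    then have "s < t" by simp
    have preimage: "outer_measure_of lborel {y \<in> {0..<1}. h y \<in> U} \<le> ennreal C * diam_pow s U"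
      if U: "ediam U \<le> ennreal 1" for U
    proof (cases "U = {}")
      case False
      let ?D = "enn2real (ediam U)"
      have D: "ediam U = ennreal ?D" "?D \<le> 1"
        using U enn2real_mono[OF U] by (auto simp: ennreal_enn2real_if top_unique)
      have "C * ?D powr t \<le> C * (if s = 0 then 1 else ?D powr s)"
        using C s \<open>s < t\<close> D(2) powr_mono'[of s t ?D] powr_le1[of t ?D] by simp
      then show ?thesis
        using outer_measure_preimage_le[OF C t h, of U ?D] D(1) C False
        unfolding diam_pow_def
        by (auto simp flip: ennreal_mult' simp: ennreal_leI elim!: order_trans split: if_splits)
    qed simp
    have "ennreal (1 / C) \<le> hausdorff_premeasure s 1 A"
      unfolding hausdorff_premeasure_def
    proof (rule INF_greatest, clarify)
      fix U :: "nat \<Rightarrow> 'a set"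
      assume U: "\<forall>i. U i \<subseteq> M \<and> ediam (U i) \<le> ennreal 1" and cover: "A \<subseteq> (\<Union>i. U i)"
      have "{0..<1} \<subseteq> (\<Union>i. {y \<in> {0..<1}. h y \<in> U i})"
        using A cover by blast
      then have "outer_measure_of lborel {0..<1::real} \<le>
          outer_measure_of lborel (\<Union>i. {y \<in> {0..<1}. h y \<in> U i})"
        by (rule outer_measure_of_mono)
      also have "\<dots> \<le> (\<Sum>i. outer_measure_of lborel {y \<in> {0..<1}. h y \<in> U i})"
        by (rule outer_measure_of_UN_le) simp
      also have "\<dots> \<le> (\<Sum>i. ennreal C * diam_pow s (U i))"
        using U preimage by (intro suminf_le) auto
      also have "\<dots> = ennreal C * (\<Sum>i. diam_pow s (U i))" by simp
      finally have "1 \<le> ennreal C * (\<Sum>i. diam_pow s (U i))" by simp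
      then have "ennreal (1 / C) * 1 \<le> ennreal (1 / C) * (ennreal C * (\<Sum>i. diam_pow s (U i)))"
        by (intro mult_left_mono) auto
      also have "\<dots> = (\<Sum>i. diam_pow s (U i))"
        using C by (simp add: mult.assoc[symmetric] flip: ennreal_mult')
      finally show "ennreal (1 / C) \<le> (\<Sum>i. diam_pow s (U i))" by simp
    qed
    also have "\<dots> \<le> hausdorff_measure s A"
      unfolding hausdorff_measure_def by (rule SUP_upper) simp
    finally show False using zero C by simp
  qed
qed

lemma tendsto_add_divide_ln_at_right_0: "((\<lambda>\<delta>. t + c / ln \<delta>) \<longlongrightarrow> (t::real)) (at_right 0)"
proof -
  have "((\<lambda>\<delta>::real. c / ln \<delta>) \<longlongrightarrow> 0) (at_right 0)"
    by (rule tendsto_divide_0[OF tendsto_const filterlim_at_bot_imp_at_infinity[OF ln_at_0]])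
  from tendsto_add[OF tendsto_const this, of t] show ?thesis by simp
qed

lemma eventually_at_right_0_less_1: "eventually (\<lambda>\<delta>::real. 0 < \<delta> \<and> \<delta> < 1) (at_right 0)"
  unfolding eventually_at_right_field by (intro exI[of _ 1]) simp

text \<open>
  The same argument for covers by \<open>n\<close> sets of diameter at most \<open>\<delta>\<close> gives \<open>1 \<le> n * C * \<delta> powr t\<close>; the
  constant \<open>C\<close> disappears after taking logarithms and dividing by \<open>- ln \<delta>\<close>.
\<close>
lemma lower_box_dim_ge:
  assumes C: "0 < C" and t: "0 < t"
    and h: "\<And>y z. y \<in> {0..<1} \<Longrightarrow> z \<in> {0..<1} \<Longrightarrow> \<bar>y - z\<bar> \<le> C * d (h y) (h z) powr t"
    and A: "h ` {0..<1} \<subseteq> A"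
  shows "ereal t \<le> lower_box_dim A"
proof -
  have bound: "ereal (t + ln C / ln \<delta>) \<le> box_ratio A \<delta>" if \<delta>: "0 < \<delta>" "\<delta> < 1" for \<delta>
  proof (cases "covering_number \<delta> A")
    case (enat n)
    let ?covers = "{F. finite F \<and> (\<forall>U\<in>F. U \<subseteq> M \<and> ediam U \<le> ennreal \<delta>) \<and> A \<subseteq> \<Union>F}"
    have "?covers \<noteq> {}"
    proof
      assume "?covers = {}"
      then have "covering_number \<delta> A = top"
        unfolding covering_number_def by (simp only: image_empty Inf_empty)
      with enat show False by (simp add: top_enat_def)
    qed
    then obtain F0 where "F0 \<in> ?covers" unfolding ex_in_conv[symmetric] by (rule exE)
    then have "covering_number \<delta> A \<in> (\<lambda>F. enat (card F)) ` ?covers"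
      unfolding covering_number_def by (rule wellorder_InfI[OF imageI])
    then obtain F where "F \<in> ?covers" "enat n = enat (card F)"
      unfolding enat by (rule imageE)
    then have F: "finite F" "\<And>U. U \<in> F \<Longrightarrow> ediam U \<le> ennreal \<delta>" "A \<subseteq> \<Union>F"
      and n: "card F = n"
      by simp_all
    define S where "S U = {y \<in> {0..<1}. h y \<in> U}" for U
    have "\<exists>E\<in>sets lborel. S U \<subseteq> E \<and> outer_measure_of lborel (S U) = emeasure lborel E" for U
      by (rule outer_measure_of_attain) simp
    then obtain E where E: "\<And>U. E U \<in> sets lborel" "\<And>U. S U \<subseteq> E U"
      "\<And>U. outer_measure_of lborel (S U) = emeasure lborel (E U)"
      by metis
    have "{0..<1} \<subseteq> (\<Union>U\<in>F. E U)"
    proof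
      fix y :: real assume "y \<in> {0..<1}"
      then obtain U where "U \<in> F" "y \<in> S U" using A F(3) unfolding S_def by blast
      then show "y \<in> (\<Union>U\<in>F. E U)" using E(2) by blast
    qed
    then have "emeasure lborel {0..<1::real} \<le> emeasure lborel (\<Union>U\<in>F. E U)"
      using E(1) F(1) by (intro emeasure_mono) auto
    also have "\<dots> \<le> (\<Sum>U\<in>F. emeasure lborel (E U))"
      using E(1) F(1) by (intro emeasure_subadditive_finite) auto
    also have "\<dots> \<le> (\<Sum>U\<in>F. ennreal (C * \<delta> powr t))"
      using E(3) outer_measure_preimage_le[OF C t h F(2)] \<delta> unfolding S_def
      by (intro sum_mono) (metis less_imp_le)
    also have "\<dots> = ennreal (real n * (C * \<delta> powr t))"
      using n C by (simp add: ennreal_mult' ennreal_of_nat_eq_real_of_nat)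
    finally have le: "1 \<le> real n * (C * \<delta> powr t)"
      using ennreal_le_iff[of "real n * (C * \<delta> powr t)" 1] C by simp
    then have "0 < real n" using C by (cases "n = 0") auto
    then have "ln (real n * (C * \<delta> powr t)) = ln (real n) + (ln C + t * ln \<delta>)"
      using C \<delta> by (simp add: ln_mult ln_powr)
    then have "- (ln C + t * ln \<delta>) \<le> ln (real n)"
      using le ln_ge_zero[of "real n * (C * \<delta> powr t)"] by simp
    then have "- (ln C + t * ln \<delta>) / - ln \<delta> \<le> ln (real n) / - ln \<delta>"
      using \<delta> by (intro divide_right_mono) (simp_all add: ln_less_zero less_imp_le)
    moreover have "- (ln C + t * ln \<delta>) / - ln \<delta> = t + ln C / ln \<delta>"
      using \<delta> ln_less_zero[of \<delta>] by (simp add: field_simps)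
    ultimately show ?thesis unfolding box_ratio_def enat by simp
  qed (simp add: box_ratio_def)
  have "ereal t = Liminf (at_right 0) (\<lambda>\<delta>. ereal (t + ln C / ln \<delta>))"
    by (rule lim_imp_Liminf[symmetric])
      (auto intro: tendsto_add_divide_ln_at_right_0)
  also have "\<dots> \<le> lower_box_dim A"
    unfolding lower_box_dim_def
    by (rule Liminf_mono, rule eventually_mono[OF eventually_at_right_0_less_1]) (use bound in auto)
  finally show ?thesis .
qed

lemma lower_box_dim_le_upper_box_dim: "lower_box_dim A \<le> upper_box_dim A"
  unfolding lower_box_dim_def upper_box_dim_def by (rule Liminf_le_Limsup) simp

lemma upper_box_dim_le:
  assumes C: "1 \<le> C" and t: "0 \<le> t"
    and cover: "\<And>\<delta>. 0 < \<delta> \<Longrightarrow> \<delta> < 1 \<Longrightarrow> \<exists>F. finite F \<and> (\<forall>U\<in>F. U \<subseteq> M \<and> ediam U \<le> ennreal \<delta>)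
      \<and> A \<subseteq> \<Union>F \<and> real (card F) \<le> C * \<delta> powr - t"
  shows "upper_box_dim A \<le> ereal t"
proof -
  have bound: "box_ratio A \<delta> \<le> ereal (t + - ln C / ln \<delta>)" if \<delta>: "0 < \<delta>" "\<delta> < 1" for \<delta>
  proof -
    obtain F where F: "finite F" "\<forall>U\<in>F. U \<subseteq> M \<and> ediam U \<le> ennreal \<delta>" "A \<subseteq> \<Union>F"
      and card: "real (card F) \<le> C * \<delta> powr - t"
      using cover[OF \<delta>] by (elim exE conjE) (rule that; assumption)
    then have le: "covering_number \<delta> A \<le> enat (card F)"
      unfolding covering_number_def by (intro INF_lower) simp
    then obtain n where n: "covering_number \<delta> A = enat n" "n \<le> card F"
      by (cases "covering_number \<delta> A") auto
    have "1 \<le> \<delta> powr - t" using \<delta> t powr_mono'[of "- t" 0 \<delta>] by simp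
    then have 1: "1 \<le> C * \<delta> powr - t" using C by (simp add: mult_ge1_I)
    have "ln (real n) \<le> ln (C * \<delta> powr - t)"
    proof (cases "n = 0")
      case False
      then show ?thesis using n card 1 by (subst ln_le_cancel_iff) auto
    qed (use 1 in simp)
    also have "\<dots> = ln C - t * ln \<delta>"
      using C \<delta> by (simp add: ln_mult ln_powr)
    finally have "ln (real n) / - ln \<delta> \<le> (ln C - t * ln \<delta>) / - ln \<delta>"
      using \<delta> by (intro divide_right_mono) (simp_all add: ln_less_zero less_imp_le)
    moreover have "(ln C - t * ln \<delta>) / - ln \<delta> = t + - ln C / ln \<delta>"
      using \<delta> ln_less_zero[of \<delta>] by (simp add: field_simps)
    ultimately show ?thesis unfolding box_ratio_def n(1) by simp
  qed
  have "upper_box_dim A \<le> Limsup (at_right 0) (\<lambda>\<delta>. ereal (t + - ln C / ln \<delta>))"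
    unfolding upper_box_dim_def
    by (rule Limsup_mono, rule eventually_mono[OF eventually_at_right_0_less_1]) (use bound in auto)
  also have "\<dots> = ereal t"
    by (rule lim_imp_Limsup) (simp_all only: lim_ereal tendsto_add_divide_ln_at_right_0, simp)
  finally show ?thesis .
qed

text \<open>
  Applied with \<open>e = s - t\<close>, the gain at scale \<open>\<delta>\<close> of an exponent \<open>s\<close> over the critical exponent \<open>t\<close>.
\<close>
lemma ennreal_eq_0_if_le_powr:
  fixes a :: ennreal
  assumes e: "0 < e" and le: "eventually (\<lambda>\<delta>. a \<le> ennreal (K * \<delta> powr e)) (at_right 0)"
  shows "a = 0"
proof -
  have "((\<lambda>\<delta>::real. \<delta> powr e) \<longlongrightarrow> 0) (at_right 0)"
    using e by (intro tendsto_zero_powrI[OF _ tendsto_const])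
      (auto intro: tendsto_ident_at simp: eventually_at_filter)
  then have "((\<lambda>\<delta>. ennreal (K * \<delta> powr e)) \<longlongrightarrow> ennreal (K * 0)) (at_right 0)"
    by (intro tendsto_ennrealI tendsto_mult tendsto_const)
  from tendsto_lowerbound[OF this le] show ?thesis by simp
qed

text \<open>
  All measures are shown to vanish for exponents strictly above the critical one only; at the
  critical exponent itself they may be positive.
\<close>
lemma ereal_Inf_le_if_all_greater:
  assumes "\<And>s. t < s \<Longrightarrow> P s"
  shows "Inf {ereal s | s. P s} \<le> ereal t"
proof (rule ereal_le_epsilon2)
  fix e :: real assume "0 < e"
  then show "Inf {ereal s | s. P s} \<le> ereal t + ereal e"
    using assms[of "t + e"] by (intro Inf_lower) auto
qed

lemma hausdorff_dim_le:
  assumes t: "0 \<le> t"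
    and cover: "\<And>\<delta>. 0 < \<delta> \<Longrightarrow> \<delta> < 1 \<Longrightarrow> \<exists>F. finite F \<and> (\<forall>U\<in>F. U \<subseteq> M \<and> ediam U \<le> ennreal \<delta>)
      \<and> A \<subseteq> \<Union>F \<and> real (card F) \<le> C * \<delta> powr - t"
  shows "hausdorff_dim A \<le> ereal t"
  unfolding hausdorff_dim_def
proof (rule ereal_Inf_le_if_all_greater)
  fix s assume s: "t < s"
  have "hausdorff_premeasure s \<delta>0 A = 0" if "0 < \<delta>0" for \<delta>0
  proof (rule ennreal_eq_0_if_le_powr)
    show "0 < s - t" using s by simp
    have "hausdorff_premeasure s \<delta>0 A \<le> ennreal (C * \<delta> powr (s - t))"
      if \<delta>: "0 < \<delta>" "\<delta> < 1" "\<delta> < \<delta>0" for \<delta>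
    proof -
      obtain F where F: "finite F" "\<forall>U\<in>F. U \<subseteq> M \<and> ediam U \<le> ennreal \<delta>" "A \<subseteq> \<Union>F"
        and card: "real (card F) \<le> C * \<delta> powr - t"
        using cover[OF \<delta>(1,2)] by (elim exE conjE) (rule that; assumption)
      obtain g where g: "bij_betw g {0..<card F} F"
        using ex_bij_betw_nat_finite[OF F(1)] by blast
      define U where "U i = (if i < card F then g i else {})" for i
      have gF: "g i \<in> F" if "i < card F" for i
        using g that by (auto simp: bij_betw_def)
      have F_le: "ediam V \<le> ennreal \<delta>0" if "V \<in> F" for V
        using F(2) that \<delta> by (meson ennreal_leI less_imp_le order_trans)
      have "(\<forall>i. U i \<subseteq> M \<and> ediam (U i) \<le> ennreal \<delta>0) \<and> A \<subseteq> (\<Union>i. U i)"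
      proof (intro conjI allI)
        show "U i \<subseteq> M" for i using gF F(2) by (auto simp: U_def)
        show "ediam (U i) \<le> ennreal \<delta>0" for i
          using gF F_le by (auto simp: U_def ediam_def)
        have "F = g ` {0..<card F}" using g by (simp add: bij_betw_def)
        moreover have "g ` {0..<card F} \<subseteq> range U" by (auto simp: U_def)
        ultimately have "F \<subseteq> range U" by (simp only:)
        then show "A \<subseteq> (\<Union>i. U i)" using F(3) Union_mono by (meson order_trans)
      qed
      then have "hausdorff_premeasure s \<delta>0 A \<le> (\<Sum>i. diam_pow s (U i))"
        unfolding hausdorff_premeasure_def by (intro INF_lower) simp
      also have "\<dots> = (\<Sum>i<card F. diam_pow s (U i))"
        by (rule suminf_finite) (auto simp: U_def diam_pow_def)
      also have "\<dots> \<le> (\<Sum>i<card F. ennreal (\<delta> powr s))"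
        using gF F(2) \<delta> s t by (intro sum_mono diam_pow_le) (auto simp: U_def)
      also have "\<dots> = ennreal (real (card F) * \<delta> powr s)"
        by (simp add: ennreal_mult' ennreal_of_nat_eq_real_of_nat)
      also have "\<dots> \<le> ennreal ((C * \<delta> powr - t) * \<delta> powr s)"
        using card by (intro ennreal_leI mult_right_mono) auto
      also have "(C * \<delta> powr - t) * \<delta> powr s = C * \<delta> powr (s - t)"
        by (simp flip: powr_add)
      finally show ?thesis .
    qed
    then show "eventually (\<lambda>\<delta>. hausdorff_premeasure s \<delta>0 A \<le> ennreal (C * \<delta> powr (s - t)))
        (at_right 0)"
      unfolding eventually_at_right_field using \<open>0 < \<delta>0\<close> by (intro exI[of _ "min 1 \<delta>0"]) auto
  qed
  then have "hausdorff_measure s A \<le> 0"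
    unfolding hausdorff_measure_def by (intro SUP_least) simp
  then show "0 \<le> s \<and> hausdorff_measure s A = 0" using s t by simp
qed

text \<open>
  The hypothesis on \<open>ball\<close> says that the image of Lebesgue measure under \<open>h\<close> gives mass at least
  \<open>r powr t / C\<close> to each ball of radius \<open>r\<close> centred in \<open>A\<close>. Disjoint balls have disjoint preimages, so
  the sum of \<open>r powr t\<close> over a packing is at most \<open>C\<close>, and the remaining factor \<open>r powr (s - t)\<close>
  tends to \<open>0\<close> with the mesh.
\<close>
lemma packing_dim_le:
  fixes h :: "real \<Rightarrow> 'a"
  assumes C: "0 \<le> C" and t: "0 \<le> t" and A: "A \<subseteq> M"
    and ball: "\<And>x r. x \<in> A \<Longrightarrow> 0 < r \<Longrightarrow> r \<le> 1 \<Longrightarrow> \<exists>J\<in>sets lborel.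
      J \<subseteq> {y \<in> {0..<1}. h y \<in> mcball x r} \<and> ennreal (r powr t) \<le> ennreal C * emeasure lborel J"
  shows "packing_dim A \<le> ereal t"
  unfolding packing_dim_def
proof (rule ereal_Inf_le_if_all_greater)
  fix s assume s: "t < s"
  define K where "K = 2 powr s * C"
  have "packing_premeasure s A \<le> ennreal (K * \<delta> powr (s - t))" if \<delta>: "0 < \<delta>" "\<delta> < 1" for \<delta>
  proof -
    have "(\<Sum>i. diam_pow s (U i)) \<le> ennreal (K * \<delta> powr (s - t))" if U: "packing \<delta> A U" for U
    proof -
      have "\<exists>J\<in>sets lborel. J \<subseteq> {y \<in> {0..<1}. h y \<in> U i} \<and>
          diam_pow s (U i) \<le> ennreal (K * \<delta> powr (s - t)) * emeasure lborel J" for i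
      proof (cases "U i = {}")
        case False
        moreover have "\<forall>i. U i = {} \<or> (\<exists>x\<in>A. \<exists>r. 0 < r \<and> r \<le> \<delta> \<and> U i = mcball x r)"
          using U unfolding packing_def by (rule conjunct2)
        ultimately have "\<exists>x\<in>A. \<exists>r. 0 < r \<and> r \<le> \<delta> \<and> U i = mcball x r"
          by metis
        then obtain x r where x: "x \<in> A" and r: "0 < r" "r \<le> \<delta>" and Ui: "U i = mcball x r"
          by blast
        have "r \<le> 1" using r \<delta> by simp
        obtain J where J: "J \<in> sets lborel" "J \<subseteq> {y \<in> {0..<1}. h y \<in> mcball x r}"
          "ennreal (r powr t) \<le> ennreal C * emeasure lborel J"
          using ball[OF x r(1) \<open>r \<le> 1\<close>] by (elim bexE conjE) (rule that; assumption)
        have "diam_pow s (U i) \<le> ennreal ((2 * r) powr s)"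
          using diam_pow_le[OF ediam_mcball_le, of r s x] r s t Ui by simp
        also have "(2 * r) powr s = 2 powr s * r powr (s - t) * r powr t"
          using r by (simp add: powr_mult mult.assoc flip: powr_add)
        also have "ennreal \<dots> \<le> ennreal (2 powr s * \<delta> powr (s - t) * r powr t)"
          using r s by (intro ennreal_leI mult_right_mono mult_left_mono powr_mono2) auto
        also have "\<dots> = ennreal (2 powr s * \<delta> powr (s - t)) * ennreal (r powr t)"
          by (simp add: ennreal_mult')
        also have "\<dots> \<le> ennreal (2 powr s * \<delta> powr (s - t)) * (ennreal C * emeasure lborel J)"
          using J(3) by (intro mult_left_mono) auto
        also have "\<dots> = ennreal (K * \<delta> powr (s - t)) * emeasure lborel J"
        proof -
          have "ennreal (K * \<delta> powr (s - t)) = ennreal (2 powr s * \<delta> powr (s - t)) * ennreal C"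
            by (subst ennreal_mult'[symmetric]) (simp_all add: K_def mult_ac)
          then show ?thesis by (simp only: mult.assoc)
        qed
        finally show ?thesis using J Ui by blast
      qed (intro bexI[of _ "{}"], auto simp: diam_pow_def)
      then obtain J where J: "\<And>i. J i \<in> sets lborel" "\<And>i. J i \<subseteq> {y \<in> {0..<1}. h y \<in> U i}"
        "\<And>i. diam_pow s (U i) \<le> ennreal (K * \<delta> powr (s - t)) * emeasure lborel (J i)"
        by metis
      have "disjoint_family J"
        using U J(2) unfolding packing_def disjoint_family_on_def by blast
      then have "(\<Sum>i. emeasure lborel (J i)) = emeasure lborel (\<Union>i. J i)"
        using J(1) by (intro suminf_emeasure) auto
      also have "\<dots> \<le> emeasure lborel {0..<1::real}"
      proof (rule emeasure_mono)
        show "(\<Union>i. J i) \<subseteq> {0..<1}" using J(2) by blast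
      qed simp
      finally have mass: "(\<Sum>i. emeasure lborel (J i)) \<le> 1" by simp
      have "(\<Sum>i. diam_pow s (U i)) \<le> (\<Sum>i. ennreal (K * \<delta> powr (s - t)) * emeasure lborel (J i))"
        using J(3) by (intro suminf_le) auto
      also have "\<dots> = ennreal (K * \<delta> powr (s - t)) * (\<Sum>i. emeasure lborel (J i))" by simp
      also have "\<dots> \<le> ennreal (K * \<delta> powr (s - t)) * 1"
        using mass by (intro mult_left_mono) auto
      finally show ?thesis by simp
    qed
    then have "(SUP U\<in>{U. packing \<delta> A U}. \<Sum>i. diam_pow s (U i)) \<le> ennreal (K * \<delta> powr (s - t))"
      by (intro SUP_least) simp
    then show ?thesis
      unfolding packing_premeasure_def using \<delta> by (intro INF_lower2[of \<delta>]) auto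
  qed
  then have "packing_premeasure s A = 0"
    using s by (intro ennreal_eq_0_if_le_powr[of "s - t" _ K]
        eventually_mono[OF eventually_at_right_0_less_1]) auto
  \<comment> \<open>As the summands vanish, the constant sequence \<open>A, A, \<dots>\<close> is a good enough decomposition.\<close>
  moreover have "packing_measure s A \<le> (\<Sum>i::nat. packing_premeasure s A)"
    unfolding packing_measure_def by (rule INF_lower2[of "\<lambda>_. A"]) (use A in auto)
  ultimately have "packing_measure s A = 0" by simp
  then show "0 \<le> s \<and> packing_measure s A = 0" using s t by simp
qed

text \<open>
  If the packing premeasure dominates an outer measure, then so does the packing measure, because the
  outer measure is countably subadditive and survives the splitting of \<open>A\<close> into countably many pieces.
  So the bound is reached without comparing packing and Hausdorff measures by a covering theorem.
\<close>
lemma packing_dim_ge: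
  fixes h :: "real \<Rightarrow> 'a"
  assumes A: "h ` {0..<1} \<subseteq> A"
    and mass: "\<And>s B. 0 \<le> s \<Longrightarrow> s < t \<Longrightarrow>
      outer_measure_of lborel {y \<in> {0..<1}. h y \<in> B} \<le> packing_premeasure s B"
  shows "ereal t \<le> packing_dim A"
  unfolding packing_dim_def
proof (rule Inf_greatest, clarify)
  fix s assume s: "0 \<le> s" and zero: "packing_measure s A = 0"
  show "ereal t \<le> ereal s"
  proof (rule ccontr)
    assume "\<not> ?thesis"
    then have "s < t" by simp
    have "1 \<le> packing_measure s A"
      unfolding packing_measure_def
    proof (rule INF_greatest, clarify)
      fix B :: "nat \<Rightarrow> 'a set" assume "A \<subseteq> (\<Union>i. B i)"
      then have "{0..<1} \<subseteq> (\<Union>i. {y \<in> {0..<1}. h y \<in> B i})"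
        using A by blast
      then have "outer_measure_of lborel {0..<1::real} \<le>
          outer_measure_of lborel (\<Union>i. {y \<in> {0..<1}. h y \<in> B i})"
        by (rule outer_measure_of_mono)
      also have "\<dots> \<le> (\<Sum>i. outer_measure_of lborel {y \<in> {0..<1}. h y \<in> B i})"
        by (rule outer_measure_of_UN_le) simp
      also have "\<dots> \<le> (\<Sum>i. packing_premeasure s (B i))"
        using mass[OF s \<open>s < t\<close>] by (intro suminf_le) auto
      finally show "1 \<le> (\<Sum>i. packing_premeasure s (B i))" by simp
    qed
    with zero show False by simp
  qed
qed

end

section \<open>Dyadic parametrization of the set\<close>

text \<open>
  The first \<open>k\<close> bits read as a binary number, the earliest bit being the most significant one.
\<close>
primrec prefix_code :: "(nat \<Rightarrow> bool) \<Rightarrow> nat \<Rightarrow> nat" where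
  "prefix_code b 0 = 0"
| "prefix_code b (Suc k) = 2 * prefix_code b k + of_bool (b k)"

text \<open>
  The binary digits of \<open>y\<close>; dyadic rationals get the expansion that ends in zeros.
\<close>
definition bits :: "real \<Rightarrow> nat \<Rightarrow> bool" where
  "bits y i \<longleftrightarrow> odd \<lfloor>2 ^ Suc i * y\<rfloor>"

lemma prefix_code_less: "prefix_code b k < 2 ^ k"
  by (induction k) auto

lemma prefix_code_eq_iff: "prefix_code b k = prefix_code c k \<longleftrightarrow> (\<forall>i<k. b i = c i)"
proof (induction k)
  case (Suc k)
  have "prefix_code b (Suc k) = prefix_code c (Suc k) \<longleftrightarrow> prefix_code b k = prefix_code c k \<and> b k = c k"
    by (cases "b k"; cases "c k") (simp_all, presburger+)
  then show ?case using Suc by (auto simp: less_Suc_eq)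
qed simp

lemma prefix_code_bits:
  assumes "y \<in> {0..<1}"
  shows "int (prefix_code (bits y) k) = \<lfloor>2 ^ k * y\<rfloor>"
proof (induction k)
  case 0
  then show ?case using assms by (simp add: eq_commute[of 0] floor_eq_iff)
next
  case (Suc k)
  let ?x = "2 ^ k * y"
  have "2 * \<lfloor>?x\<rfloor> \<le> \<lfloor>2 * ?x\<rfloor>" "\<lfloor>2 * ?x\<rfloor> \<le> 2 * \<lfloor>?x\<rfloor> + 1" by linarith+
  then have "\<lfloor>2 * ?x\<rfloor> = 2 * \<lfloor>?x\<rfloor> + of_bool (odd \<lfloor>2 * ?x\<rfloor>)"
    by (cases "odd \<lfloor>2 * ?x\<rfloor>") (simp_all, presburger+)
  then show ?case using Suc by (simp add: bits_def mult.assoc)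
qed

text \<open>
  The points whose binary expansion has a given prefix form a half-open dyadic interval; this makes
  Lebesgue measure the fair coin measure on bits.
\<close>
lemma prefix_code_bits_eq_iff:
  assumes "y \<in> {0..<1}"
  shows "prefix_code (bits y) k = a \<longleftrightarrow> y \<in> {real a / 2 ^ k..<(real a + 1) / 2 ^ k}"
proof -
  have "prefix_code (bits y) k = a \<longleftrightarrow> \<lfloor>2 ^ k * y\<rfloor> = int a"
    using prefix_code_bits[OF assms, of k] by linarith
  also have "\<dots> \<longleftrightarrow> real a \<le> 2 ^ k * y \<and> 2 ^ k * y < real a + 1"
    by (simp add: floor_eq_iff)
  also have "\<dots> \<longleftrightarrow> y \<in> {real a / 2 ^ k..<(real a + 1) / 2 ^ k}"
    by (auto simp: field_simps)
  finally show ?thesis .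
qed

text \<open>
  Agreement on \<open>k\<close> bits is agreement on the first \<open>4 * k + 1\<close> signs. Each bit occupies four signs, so
  it costs a factor \<open>2 ^ 4 = 16\<close> in distance: the origin of the dimension \<open>1/4\<close>.
\<close>
lemma block_seq_dist_le:
  assumes "\<And>i. i < k \<Longrightarrow> b i = c i"
  shows "sign_dist (block_seq b) (block_seq c) \<le> 1 / 16 ^ k"
proof -
  have "block_seq b j = block_seq c j" if "1 \<le> j" "j \<le> 4 * k + 1" for j
  proof (cases "j = 1")
    case False
    then have "(j - 2) div 4 < k" using that by linarith
    then show ?thesis using assms unfolding block_seq_def by simp
  qed (simp add: block_seq_def)
  then have "sign_dist (block_seq b) (block_seq c) \<le> 2 / 2 ^ (4 * k + 1)"
    by (intro sign_dist_le_tail block_seq_in_sign_seqs)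
  then show ?thesis by (simp add: power_mult)
qed

lemma block_seq_dist_ge:
  assumes "b i \<noteq> c i"
  shows "1 / (2 * 16 ^ i) \<le> sign_dist (block_seq b) (block_seq c)"
proof -
  have "block_seq b (4 * i + 2) \<noteq> block_seq c (4 * i + 2)"
    unfolding block_seq_block using assms by simp
  then have "2 / 2 ^ (4 * i + 2) \<le> sign_dist (block_seq b) (block_seq c)"
    by (intro sign_dist_ge_term block_seq_in_sign_seqs) auto
  then show ?thesis by (simp add: power_add power_mult)
qed

lemma powr_quarter: "(1 / 16 ^ k) powr (1/4) = 1 / (2::real) ^ k"
proof -
  have "1 / 16 ^ k = ((1 / 2 ^ k) ^ 4 :: real)"
    by (simp add: power_one_over flip: power_mult) (simp add: mult.commute[of k] power_mult)
  also have "\<dots> = (1 / 2 ^ k) powr 4" by (simp add: powr_numeral del: power_one_over)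
  finally have "(1 / 16 ^ k) powr (1/4) = ((1 / 2 ^ k) powr 4) powr (1/4 :: real)" by (rule arg_cong)
  then show ?thesis by (simp only: powr_powr) simp
qed

lemma ex_inverse_power_16_le: "0 < r \<Longrightarrow> \<exists>k. 1 / 16 ^ k \<le> (r::real)"
  using real_arch_pow_inv[of r "1/16"] by (auto simp: power_one_over intro: less_imp_le)

text \<open>
  The scale \<open>1 / 16 ^ k\<close> fitting to a radius \<open>r\<close>: the least \<open>k\<close> with \<open>1 / 16 ^ k \<le> r\<close> loses at most a
  factor \<open>16\<close> in \<open>r\<close>, hence a factor \<open>2\<close> in its fourth root.
\<close>
lemma ex_scale:
  assumes r: "0 < r" "r \<le> (1::real)"
  shows "\<exists>k. 1 / 16 ^ k \<le> r \<and> r powr (1/4) \<le> 2 / 2 ^ k"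
proof -
  have ex: "\<exists>k. 1 / 16 ^ k \<le> r"
    using r(1) by (rule ex_inverse_power_16_le)
  define k where "k = (LEAST k. 1 / 16 ^ k \<le> r)"
  have k: "1 / 16 ^ k \<le> r" unfolding k_def using ex by (rule LeastI_ex)
  have "r powr (1/4) \<le> 2 / 2 ^ k"
  proof (cases k)
    case 0
    then show ?thesis using r powr_le1[of "1/4" r] by simp
  next
    case (Suc m)
    then have "m < (LEAST k. 1 / 16 ^ k \<le> r)" unfolding k_def by simp
    then have "\<not> 1 / 16 ^ m \<le> r" by (rule not_less_Least)
    then have "r powr (1/4) \<le> (1 / 16 ^ m) powr (1/4)" using r by (intro powr_mono2) auto
    then show ?thesis unfolding powr_quarter Suc by simp
  qed
  with k show ?thesis by blast
qed

definition cantor_point :: "real \<Rightarrow> nat \<Rightarrow> int" where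
  "cantor_point y = block_seq (bits y)"

text \<open>
  If the expansions of \<open>y\<close> and \<open>z\<close> first differ at bit \<open>i\<close>, then \<open>y\<close> and \<open>z\<close> lie in a common dyadic
  interval of length \<open>1 / 2 ^ i\<close>, whereas their images are at distance at least \<open>1 / (2 * 16 ^ i)\<close>.
\<close>
lemma abs_diff_le_cantor_point_dist:
  assumes y: "y \<in> {0..<1}" and z: "z \<in> {0..<1}"
  shows "\<bar>y - z\<bar> \<le> 2 * sign_dist (cantor_point y) (cantor_point z) powr (1/4)"
proof (cases "y = z")
  case False
  have close: "\<bar>y - z\<bar> < 1 / 2 ^ k" if "prefix_code (bits y) k = prefix_code (bits z) k" for k
    using that prefix_code_bits_eq_iff[OF y, of k "prefix_code (bits y) k"]
      prefix_code_bits_eq_iff[OF z, of k "prefix_code (bits z) k"] by (auto simp: add_divide_distrib)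
  have "\<exists>i. bits y i \<noteq> bits z i"
  proof (rule ccontr)
    assume "\<not> ?thesis"
    then have "prefix_code (bits y) k = prefix_code (bits z) k" for k by (simp add: prefix_code_eq_iff)
    then have "\<bar>y - z\<bar> < (1 / 2) ^ k" for k using close[of k] by (simp add: power_one_over)
    moreover obtain k where "(1 / 2) ^ k < \<bar>y - z\<bar>"
      using real_arch_pow_inv[of "\<bar>y - z\<bar>" "1/2"] False by auto
    ultimately show False by (meson less_asym)
  qed
  then obtain i where i: "bits y i \<noteq> bits z i" "\<And>j. j < i \<Longrightarrow> bits y j = bits z j"
    using exists_least_iff[of "\<lambda>i. bits y i \<noteq> bits z i"] by blast
  \<comment> \<open>The factor \<open>2\<close> of the statement pays for the step from \<open>16 ^ i\<close> to \<open>16 ^ Suc i\<close>, whose fourth root is exact.\<close>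
  have "\<bar>y - z\<bar> \<le> 1 / 2 ^ i"
    using close[of i] i(2) by (simp add: prefix_code_eq_iff)
  also have "\<dots> = 2 * (1 / 16 ^ Suc i) powr (1/4)" unfolding powr_quarter by simp
  also have "\<dots> \<le> 2 * sign_dist (cantor_point y) (cantor_point z) powr (1/4)"
  proof (intro mult_left_mono powr_mono2)
    have "1 / 16 ^ Suc i \<le> 1 / (2 * 16 ^ i :: real)" by (simp add: field_simps)
    also have "\<dots> \<le> sign_dist (cantor_point y) (cantor_point z)"
      unfolding cantor_point_def using i(1) by (rule block_seq_dist_ge)
    finally show "1 / 16 ^ Suc i \<le> sign_dist (cantor_point y) (cantor_point z)" .
  qed auto
  finally show ?thesis .
qed simp

interpretation signs: Metric_space sign_seqs sign_dist
  by (rule Metric_space_sign_seqs)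

text \<open>
  At scale \<open>1 / 16 ^ k\<close> the \<open>2 ^ k\<close> cylinders of sequences with a common prefix of \<open>k\<close> bits suffice.
\<close>
lemma ex_cover_N1:
  assumes \<delta>: "0 < \<delta>" "\<delta> < 1"
  shows "\<exists>F. finite F \<and> (\<forall>U\<in>F. U \<subseteq> sign_seqs \<and> signs.ediam U \<le> ennreal \<delta>)
    \<and> N1 \<subseteq> \<Union>F \<and> real (card F) \<le> 2 * \<delta> powr - (1/4)"
proof -
  obtain k where k: "1 / 16 ^ k \<le> \<delta>" "\<delta> powr (1/4) \<le> 2 / 2 ^ k"
    using ex_scale[of \<delta>] \<delta> by auto
  define cyl where "cyl a = block_seq ` {b. prefix_code b k = a}" for a
  let ?F = "cyl ` {..<2 ^ k}"
  have "signs.ediam (cyl a) \<le> ennreal \<delta>" for a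
  proof (rule signs.ediam_le)
    fix u v assume "u \<in> cyl a" "v \<in> cyl a"
    then obtain b c where "u = block_seq b" "v = block_seq c" "prefix_code b k = prefix_code c k"
      unfolding cyl_def by auto
    then show "sign_dist u v \<le> \<delta>"
      using block_seq_dist_le[of k b c] k(1) by (simp add: prefix_code_eq_iff)
  qed
  moreover have "cyl a \<subseteq> sign_seqs" for a
    unfolding cyl_def using block_seq_in_sign_seqs by auto
  moreover have "N1 \<subseteq> \<Union>?F"
    unfolding N1_eq_range_block_seq cyl_def using prefix_code_less by auto
  moreover have "real (card ?F) \<le> 2 * \<delta> powr - (1/4)"
  proof -
    have "card ?F \<le> 2 ^ k" using card_image_le[of "{..<2 ^ k :: nat}" cyl] by simp
    then have "real (card ?F) \<le> 2 ^ k" by (metis of_nat_le_iff of_nat_numeral of_nat_power)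
    also have "\<dots> \<le> 2 * \<delta> powr - (1/4)"
      using k(2) \<delta> by (simp add: powr_minus field_simps)
    finally show ?thesis .
  qed
  ultimately show ?thesis by (intro exI[of _ ?F]) simp
qed

text \<open>
  A ball centred in the set contains the cylinder of a prefix of its centre, and the parameters of
  that cylinder form a dyadic interval.
\<close>
lemma ex_interval_in_ball:
  assumes x: "x \<in> N1" and r: "0 < r" "r \<le> 1"
  shows "\<exists>J\<in>sets lborel. J \<subseteq> {y \<in> {0..<1}. cantor_point y \<in> signs.mcball x r}
    \<and> ennreal (r powr (1/4)) \<le> ennreal 2 * emeasure lborel J"
proof -
  obtain b where b: "x = block_seq b" using x N1_eq_range_block_seq by blast
  obtain k where k: "1 / 16 ^ k \<le> r" "r powr (1/4) \<le> 2 / 2 ^ k"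
    using ex_scale[OF r] by blast
  let ?a = "prefix_code b k"
  let ?J = "{real ?a / 2 ^ k..<(real ?a + 1) / 2 ^ k}"
  have "real ?a + 1 \<le> 2 ^ k"
    using prefix_code_less[of b k] by (metis Suc_leI add.commute of_nat_Suc of_nat_le_iff of_nat_numeral of_nat_power)
  then have J1: "?J \<subseteq> {0..<1}"
    by (auto simp: field_simps intro: order_less_le_trans order_trans[of 0])
  have "cantor_point y \<in> signs.mcball x r" if y: "y \<in> ?J" for y
  proof -
    have "y \<in> {0..<1}" using J1 y by (rule subsetD)
    then have "prefix_code b k = prefix_code (bits y) k" using prefix_code_bits_eq_iff[of y k ?a] y by simp
    then have "sign_dist x (cantor_point y) \<le> 1 / 16 ^ k"
      unfolding b cantor_point_def by (intro block_seq_dist_le) (simp add: prefix_code_eq_iff)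
    then show ?thesis
      using k(1) unfolding b cantor_point_def by (simp add: block_seq_in_sign_seqs)
  qed
  moreover have "ennreal (r powr (1/4)) \<le> ennreal 2 * emeasure lborel ?J"
  proof -
    have "emeasure lborel ?J = ennreal (1 / 2 ^ k)"
      by (subst emeasure_lborel_Ico) (auto simp: divide_right_mono simp flip: diff_divide_distrib)
    then have "ennreal 2 * emeasure lborel ?J = ennreal (2 / 2 ^ k)"
      by (simp only: ennreal_mult'[symmetric]) simp
    then show ?thesis using k(2) by (simp only: ennreal_leI)
  qed
  moreover have "?J \<in> sets lborel" by simp
  ultimately show ?thesis using J1 by blast
qed

text \<open>
  Let \<open>n\<close> be the number of dyadic intervals of length \<open>1 / 2 ^ k\<close> that contain a parameter of a point
  of \<open>B\<close>. The outer measure is at most \<open>n / 2 ^ k\<close>. On the other hand, one such point for each interval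
  gives centres of \<open>n\<close> disjoint balls of radius \<open>1 / 16 ^ k\<close>, and each of them has weight at least
  \<open>(1 / 16 ^ k) powr (1/4) = 1 / 2 ^ k\<close>.
\<close>
lemma outer_measure_le_packing_premeasure:
  assumes s: "0 \<le> s" "s < 1/4"
  shows "outer_measure_of lborel {y \<in> {0..<1}. cantor_point y \<in> B} \<le> signs.packing_premeasure s B"
  unfolding signs.packing_premeasure_def
proof (rule INF_greatest)
  fix \<delta> :: real assume "\<delta> \<in> {0<..}"
  then obtain k where k: "1 / 16 ^ k \<le> \<delta>"
    using ex_inverse_power_16_le by auto
  let ?T = "{y \<in> {0..<1}. cantor_point y \<in> B}"
  define r :: real where "r = 1 / 16 ^ k"
  define S where "S = (\<lambda>y. prefix_code (bits y) k) ` ?T"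
  have S: "finite S"
    using prefix_code_less by (intro finite_subset[of S "{..<2 ^ k}"]) (auto simp: S_def)
  have "\<forall>a\<in>S. \<exists>y. y \<in> ?T \<and> prefix_code (bits y) k = a" unfolding S_def by blast
  from bchoice[OF this] obtain p where pS: "\<forall>a\<in>S. p a \<in> ?T \<and> prefix_code (bits (p a)) k = a"
    by (elim exE) (rule that)
  note p = bspec[OF pS, THEN conjunct1] bspec[OF pS, THEN conjunct2]
  define U where "U a = (if a \<in> S then signs.mcball (cantor_point (p a)) r else {})" for a
  \<comment> \<open>Distinct prefixes differ at some bit \<open>i < k\<close>, so the centres are at distance at least \<open>8 * r\<close>.\<close>
  have sep: "2 * r < sign_dist (cantor_point (p a)) (cantor_point (p a'))"
    if "a \<in> S" "a' \<in> S" "a \<noteq> a'" for a a'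
  proof -
    have "prefix_code (bits (p a)) k \<noteq> prefix_code (bits (p a')) k" using p(2) that by simp
    then obtain i where i: "i < k" "bits (p a) i \<noteq> bits (p a') i"
      by (auto simp: prefix_code_eq_iff)
    have "16 ^ Suc i \<le> (16 ^ k :: real)" using i(1) by (intro power_increasing) auto
    moreover have "0 < (16 ^ i :: real)" by simp
    ultimately have "4 * 16 ^ i < (16 ^ k :: real)" unfolding power_Suc by linarith
    then have "2 * r < 1 / (2 * 16 ^ i)" unfolding r_def by (simp add: field_simps)
    also have "\<dots> \<le> sign_dist (cantor_point (p a)) (cantor_point (p a'))"
      unfolding cantor_point_def using i(2) by (rule block_seq_dist_ge)
    finally show ?thesis .
  qed
  have "disjoint_family U"
    unfolding disjoint_family_on_def
  proof (intro ballI impI)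
    fix a a' :: nat assume "a \<noteq> a'"
    show "U a \<inter> U a' = {}"
    proof (rule ccontr)
      assume "U a \<inter> U a' \<noteq> {}"
      then obtain w where "w \<in> U a" "w \<in> U a'" by blast
      then have "a \<in> S" "a' \<in> S" "w \<in> signs.mcball (cantor_point (p a)) r"
        "w \<in> signs.mcball (cantor_point (p a')) r" by (auto simp: U_def split: if_splits)
      then show False
        using sep[OF _ _ \<open>a \<noteq> a'\<close>] signs.triangle'[of "cantor_point (p a)" w "cantor_point (p a')"]
        by auto
    qed
  qed
  moreover have "0 < r" unfolding r_def by simp
  have "U a = {} \<or> (\<exists>x\<in>B. \<exists>\<rho>. 0 < \<rho> \<and> \<rho> \<le> \<delta> \<and> U a = signs.mcball x \<rho>)" for a
  proof (cases "a \<in> S")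
    case True
    then have "cantor_point (p a) \<in> B" using p(1) by blast
    moreover have "U a = signs.mcball (cantor_point (p a)) r" using True by (simp add: U_def)
    ultimately show ?thesis using \<open>0 < r\<close> k unfolding r_def by blast
  qed (simp add: U_def)
  ultimately have "signs.packing \<delta> B U"
    unfolding signs.packing_def by blast
  have "?T \<subseteq> (\<Union>a\<in>S. {real a / 2 ^ k..<(real a + 1) / 2 ^ k})"
  proof
    fix y assume y: "y \<in> ?T"
    then have "y \<in> {real (prefix_code (bits y) k) / 2 ^ k..<(real (prefix_code (bits y) k) + 1) / 2 ^ k}"
      using prefix_code_bits_eq_iff[of y k] by blast
    then show "y \<in> (\<Union>a\<in>S. {real a / 2 ^ k..<(real a + 1) / 2 ^ k})"
      using y unfolding S_def by blast
  qed
  then have "outer_measure_of lborel ?T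
      \<le> outer_measure_of lborel (\<Union>a\<in>S. {real a / 2 ^ k..<(real a + 1) / 2 ^ k})"
    by (rule outer_measure_of_mono)
  also have "\<dots> = emeasure lborel (\<Union>a\<in>S. {real a / 2 ^ k..<(real a + 1) / 2 ^ k})"
    using S by (intro outer_measure_of_eq) auto
  also have "\<dots> \<le> (\<Sum>a\<in>S. emeasure lborel {real a / 2 ^ k..<(real a + 1) / 2 ^ k})"
    using S by (intro emeasure_subadditive_finite) auto
  also have "\<dots> \<le> (\<Sum>a\<in>S. signs.diam_pow s (U a))"
  proof (rule sum_mono)
    fix a assume a: "a \<in> S"
    let ?x = "cantor_point (p a)"
    \<comment> \<open>The partner \<open>?x'\<close> of the centre lies at distance exactly \<open>2 / 2 ^ (4 * k + 1) = r\<close>. It leaves the set, but balls belong to the ambient space.\<close>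
    let ?x' = "?x(4 * k + 1 := - ?x (4 * k + 1))"
    have x: "?x \<in> sign_seqs" unfolding cantor_point_def by (rule block_seq_in_sign_seqs)
    have x': "?x' \<in> sign_seqs" "sign_dist ?x ?x' = r"
      using sign_dist_flip[OF x, of "4 * k + 1"] by (simp_all add: r_def power_mult)
    have "emeasure lborel {real a / 2 ^ k..<(real a + 1) / 2 ^ k} = ennreal (1 / 2 ^ k)"
      by (subst emeasure_lborel_Ico) (auto simp: divide_right_mono simp flip: diff_divide_distrib)
    also have "1 / 2 ^ k = r powr (1/4)" unfolding r_def powr_quarter ..
    also have "ennreal \<dots> \<le> ennreal (r powr s)"
      using s by (intro ennreal_leI powr_mono') (auto simp: r_def)
    also have "\<dots> \<le> signs.diam_pow s (U a)"
    proof (rule signs.diam_pow_ge)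
      show "?x \<in> U a" "?x' \<in> U a" using a x x' \<open>0 < r\<close> by (simp_all add: U_def)
      show "signs.ediam (U a) < \<infinity>"
        using signs.ediam_mcball_le[of ?x r] a by (simp add: U_def order_le_less_trans)
    qed (use x' s \<open>0 < r\<close> in simp_all)
    finally show "emeasure lborel {real a / 2 ^ k..<(real a + 1) / 2 ^ k} \<le> signs.diam_pow s (U a)" .
  qed
  also have "\<dots> = (\<Sum>a. signs.diam_pow s (U a))"
    using S by (intro suminf_finite[symmetric]) (auto simp: U_def signs.diam_pow_def)
  also have "\<dots> \<le> (SUP U\<in>{U. signs.packing \<delta> B U}. \<Sum>i. signs.diam_pow s (U i))"
    using \<open>signs.packing \<delta> B U\<close> by (intro SUP_upper) simp
  finally show "outer_measure_of lborel ?T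
      \<le> (SUP U\<in>{U. signs.packing \<delta> B U}. \<Sum>i. signs.diam_pow s (U i))" .
qed

theorem theorem3p2:
  shows "Metric_space.hausdorff_dim sign_seqs sign_dist N1 = 1/4
       \<and> Metric_space.packing_dim sign_seqs sign_dist N1 = 1/4
       \<and> Metric_space.has_box_dim sign_seqs sign_dist N1 (1/4)"
proof -
  have range: "cantor_point ` {0..<1} \<subseteq> N1"
    unfolding N1_eq_range_block_seq cantor_point_def by blast
  have sub: "N1 \<subseteq> sign_seqs" unfolding N1_def by blast
  have quarter: "ereal (1/4) = 1/4" by (simp add: ereal_divide[symmetric] one_ereal_def)
  have "signs.hausdorff_dim N1 = ereal (1/4)"
    by (intro antisym signs.hausdorff_dim_le[OF _ ex_cover_N1]
        signs.hausdorff_dim_ge[OF _ _ abs_diff_le_cantor_point_dist range]) auto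
  moreover have "signs.packing_dim N1 = ereal (1/4)"
    by (intro antisym signs.packing_dim_le[OF _ _ sub ex_interval_in_ball]
        signs.packing_dim_ge[OF range outer_measure_le_packing_premeasure]) auto
  moreover have "ereal (1/4) \<le> signs.lower_box_dim N1"
    by (rule signs.lower_box_dim_ge[OF _ _ abs_diff_le_cantor_point_dist range]) auto
  moreover have "signs.upper_box_dim N1 \<le> ereal (1/4)"
    by (rule signs.upper_box_dim_le[OF _ _ ex_cover_N1]) auto
  moreover note signs.lower_box_dim_le_upper_box_dim[of N1]
  ultimately show ?thesis
    unfolding signs.has_box_dim_def quarter by (metis order_antisym order_trans)
qed

end
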